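(* Let $p,q\ge1$, $d=p+q$, and let $\Sigma_1\in\mathbb{S}^p_\ge$, $\Sigma_2\in\mathbb{S}^q_\ge$ be non-zero, with eigenvalues $\lambda_{1,1}\ge\dots\ge\lambda_{p,1}\ge0$ and $\lambda_{1,2}\ge\dots\ge\lambda_{q,2}\ge0$, respectively, and set $\lambda_{j,2}=0$ for $j\ge q+1$. Let $\Psi_m$ and $\Sigma_m$ be as defined in the context. Then $$\operatorname{tr}(\Psi_m\Psi_m^\top)=\sum_{j=1}^p\lambda_{j,1}\lambda_{j,2},$$ and this is the maximal value of $\operatorname{tr}(\Psi\Psi^\top)$ over all $\Sigma=\begin{bmatrix}\Sigma_1&\Psi\\ \Psi^\top&\Sigma_2\end{bmatrix}\in\Gamma(\Sigma_1,\Sigma_2)$. Defining, for $\Sigma\in\Gamma(\Sigma_1,\Sigma_2)$, the adjusted RV coefficient $$\overline{\mathrm{RV}}(\Sigma)=\frac{\mathrm{RV}(\Sigma)}{\mathrm{RV}(\Sigma_m)}=\frac{\operatorname{tr}(\Psi\Psi^\top)}{\operatorname{tr}(\Psi_m\Psi_m^\top)},$$ we have $0\le\mathrm{RV}(\Sigma)\le\overline{\mathrm{RV}}(\Sigma)\le1$ for all $\Sigma\in\Gamma(\Sigma_1,\Sigma_2)$, and, given $\Sigma_1$ and $\Sigma_2$, $\overline{\mathrm{RV}}$ takes on all values between $0$ and $1$ on $\Gamma(\Sigma_1,\Sigma_2)$.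
   Context: $\mathbb{S}^m_{\ge}$ is the set of real symmetric positive semi-definite $m\times m$ matrices. $\Gamma(\Sigma_1,\Sigma_2)$ is the set of all $\Sigma\in\mathbb{S}^{p+q}_{\ge}$ with upper left $p\times p$ diagonal block $\Sigma_1$ and lower right $q\times q$ diagonal block $\Sigma_2$. The RV coefficient of $\Sigma=\begin{bmatrix}\Sigma_1&\Psi\\ \Psi^\top&\Sigma_2\end{bmatrix}$ is $\mathrm{RV}(\Sigma)=\operatorname{tr}(\Psi\Psi^\top)/\bigl(\operatorname{tr}(\Sigma_1^2)\operatorname{tr}(\Sigma_2^2)\bigr)^{1/2}$. Eigendecompositions: $\Sigma_j=U_j\Lambda_jU_j^\top$, $j\in\{1,2\}$, with $U_j$ orthogonal and $\Lambda_j$ diagonal containing the eigenvalues of $\Sigma_j$ in decreasing order (counting multiplicities). $\Psi_m=U_1\Lambda_1^{1/2}\Pi\Lambda_2^{1/2}U_2^\top$, where $\Pi\in\mathbb{R}^{p\times q}$ is the $p\times q$ upper left block of $I_d$, and $\Sigma_m=\begin{bmatrix}\Sigma_1&\Psi_m\\ \Psi_m^\top&\Sigma_2\end{bmatrix}$. *)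

theory Defs
  imports Complex_Main "HOL-Library.Multiset" "Jordan_Normal_Form.Char_Poly"
begin

definition mat_trace :: "'a :: comm_monoid_add mat \<Rightarrow> 'a" where
  "mat_trace A = (\<Sum>i < dim_row A. A $$ (i, i))"

definition psd_mats :: "nat \<Rightarrow> real mat set" where
  "psd_mats m = {A \<in> carrier_mat m m. A\<^sup>T = A \<and> (\<forall>v \<in> carrier_vec m. 0 \<le> v \<bullet> (A *\<^sub>v v))}"

definition upper_left_block :: "nat \<Rightarrow> nat \<Rightarrow> 'a mat \<Rightarrow> 'a mat" where
  "upper_left_block r c S = (case split_block S r c of (A, B, C, D) \<Rightarrow> A)"

definition upper_right_block :: "nat \<Rightarrow> nat \<Rightarrow> 'a mat \<Rightarrow> 'a mat" where
  "upper_right_block r c S = (case split_block S r c of (A, B, C, D) \<Rightarrow> B)"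

definition lower_right_block :: "nat \<Rightarrow> nat \<Rightarrow> 'a mat \<Rightarrow> 'a mat" where
  "lower_right_block r c S = (case split_block S r c of (A, B, C, D) \<Rightarrow> D)"

definition Gamma_set :: "nat \<Rightarrow> nat \<Rightarrow> real mat \<Rightarrow> real mat \<Rightarrow> real mat set" where
  "Gamma_set p q S1 S2 =
     {S \<in> psd_mats (p + q). upper_left_block p p S = S1 \<and> lower_right_block p p S = S2}"

text \<open>The cross block \<open>\<Psi>\<close> of a matrix whose upper left diagonal block is \<open>p \<times> p\<close>.\<close>

abbreviation cross_block :: "nat \<Rightarrow> real mat \<Rightarrow> real mat" where
  "cross_block p S \<equiv> upper_right_block p p S"

definition RV :: "nat \<Rightarrow> real mat \<Rightarrow> real" where
  "RV p S = mat_trace (cross_block p S * (cross_block p S)\<^sup>T) /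
     sqrt (mat_trace (upper_left_block p p S ^\<^sub>m 2) * mat_trace (lower_right_block p p S ^\<^sub>m 2))"

text \<open>The real eigenvalues with algebraic multiplicity, in decreasing order, indexed from \<open>0\<close>
  and continued by \<open>0\<close>. For a real symmetric matrix the list has length \<open>dim_row A\<close>.\<close>

definition eigenvalues_decreasing :: "real mat \<Rightarrow> real list" where
  "eigenvalues_decreasing A = rev (sorted_list_of_multiset (proots (char_poly A)))"

definition eigval :: "real mat \<Rightarrow> nat \<Rightarrow> real" where
  "eigval A j =
     (if j < length (eigenvalues_decreasing A) then eigenvalues_decreasing A ! j else 0)"

definition eigendecomposition :: "nat \<Rightarrow> real mat \<Rightarrow> real mat \<Rightarrow> bool" where
  "eigendecomposition m A U \<longleftrightarrow>
     U \<in> carrier_mat m m \<and> U * U\<^sup>T = 1\<^sub>m m \<and> U\<^sup>T * U = 1\<^sub>m m \<and>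
     A = U * mat_diag m (eigval A) * U\<^sup>T"

definition Psi_m :: "nat \<Rightarrow> nat \<Rightarrow> real mat \<Rightarrow> real mat \<Rightarrow> real mat \<Rightarrow> real mat \<Rightarrow> real mat" where
  "Psi_m p q S1 U1 S2 U2 =
     U1 * mat_diag p (\<lambda>j. sqrt (eigval S1 j)) * upper_left_block p q (1\<^sub>m (p + q)) *
       mat_diag q (\<lambda>j. sqrt (eigval S2 j)) * U2\<^sup>T"

definition Sigma_m :: "nat \<Rightarrow> nat \<Rightarrow> real mat \<Rightarrow> real mat \<Rightarrow> real mat \<Rightarrow> real mat \<Rightarrow> real mat" where
  "Sigma_m p q S1 U1 S2 U2 =
     four_block_mat S1 (Psi_m p q S1 U1 S2 U2) ((Psi_m p q S1 U1 S2 U2)\<^sup>T) S2"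

definition RV_adj ::
    "nat \<Rightarrow> nat \<Rightarrow> real mat \<Rightarrow> real mat \<Rightarrow> real mat \<Rightarrow> real mat \<Rightarrow> real mat \<Rightarrow> real" where
  "RV_adj p q S1 U1 S2 U2 S = RV p S / RV p (Sigma_m p q S1 U1 S2 U2)"

end

theory Submission
  imports Defs "HOL-Analysis.L2_Norm"
begin

text \<open>
  Orthogonal changes of basis leave \<open>tr (\<Psi> \<Psi>\<^sup>T)\<close>, the sum of the squared entries of \<open>\<Psi>\<close>,
  unchanged. So both diagonal blocks may be taken diagonal, with entries \<open>l i\<close> and \<open>m j\<close>,
  and \<open>M = U1\<^sup>T \<Psi> U2\<close> takes the place of \<open>\<Psi>\<close> (lemma \<open>psd_four_block_iff_coupled_form\<close>).

  Minimising the quadratic form over the second group of variables while the first is a unit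
  vector (a Schur complement) gives \<open>\<Sum>j. M i j\<^sup>2 / m j \<le> l i\<close>, and symmetrically for columns.
  Hence \<open>W i j = M i j\<^sup>2 / (l i * m j)\<close> is doubly substochastic, and the quantity to be
  maximised is the linear functional \<open>\<Sum>i j. W i j * (l i * m j)\<close> of \<open>W\<close>. For decreasing
  nonnegative \<open>l\<close> and \<open>m\<close> the best \<open>W\<close> is the identity, by linear programming duality with
  an explicit dual solution (lemma \<open>substochastic_sum_le\<close>). This gives the upper bound
  \<open>\<Sum>j. l j * m j\<close>.

  Conversely, \<open>\<Psi>\<^sub>m\<close> becomes the diagonal coupling with entries \<open>sqrt (l i * m i)\<close>. Scaled by
  \<open>t \<in> [0, 1]\<close>, its form is a convex combination of sums of squares, so
  \<open>t \<Psi>\<^sub>m\<close> is admissible (lemma \<open>scaled_Psi_m_in_Gamma_set\<close>): \<open>t = 1\<close> attains the bound, and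
  \<open>t = sqrt r\<close> gives the adjusted coefficient \<open>r\<close>. Finally \<open>RV (\<Sigma>\<^sub>m) \<le> 1\<close> is the
  Cauchy--Schwarz inequality for the two eigenvalue sequences, so dividing by it can only
  increase \<open>RV\<close>.
\<close>

section \<open>Doubly substochastic weights\<close>

text \<open>
  The sums \<open>u\<close> and \<open>v\<close> in the proof solve the dual of the assignment problem with gain
  \<open>a i * b j\<close>: they satisfy \<open>a i * b j \<le> u i + v j\<close>, with equality on the diagonal. The first
  fact bounds the weighted gain of any substochastic \<open>W\<close> by \<open>\<Sum>i. u i + v i\<close>, the second
  evaluates that bound. Both \<open>u\<close> and \<open>v\<close> come from telescoping \<open>a i * b i\<close> by the product rule
  for differences.
\<close>

lemma substochastic_sum_le:
  fixes W :: "nat \<Rightarrow> nat \<Rightarrow> real"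
  assumes W: "\<And>i j. i < n \<Longrightarrow> j < n \<Longrightarrow> 0 \<le> W i j"
    and rows: "\<And>i. i < n \<Longrightarrow> (\<Sum>j<n. W i j) \<le> 1"
    and cols: "\<And>j. j < n \<Longrightarrow> (\<Sum>i<n. W i j) \<le> 1"
    and a: "antimono a" and b: "antimono b" and an: "a n = 0" and bn: "b n = 0"
  shows "(\<Sum>i<n. \<Sum>j<n. W i j * (a i * b j)) \<le> (\<Sum>i<n. a i * b i)"
proof -
  define u where "u i = (\<Sum>k=i..<n. (a k - a (Suc k)) * b k)" for i
  define v where "v j = (\<Sum>k=j..<n. a (Suc k) * (b k - b (Suc k)))" for j
  have a0: "0 \<le> a i" if "i \<le> n" for i using antimonoD[OF a that] an by simp
  have b0: "0 \<le> b i" if "i \<le> n" for i using antimonoD[OF b that] bn by simp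
  have da: "0 \<le> a k - a (Suc k)" and db: "0 \<le> b k - b (Suc k)" for k
    using antimonoD[OF a, of k "Suc k"] antimonoD[OF b, of k "Suc k"] by auto
  have u0: "0 \<le> u i" and v0: "0 \<le> v i" for i
    unfolding u_def v_def by (auto intro!: sum_nonneg mult_nonneg_nonneg da db a0 b0)
  have tele: "(\<Sum>k=i..<j. c k - c (Suc k)) = c i - c j" if "i \<le> j" for i j and c :: "nat \<Rightarrow> real"
    using sum_Suc_diff'[OF that, of "\<lambda>k. - c k"] by simp
  have diag: "u i + v i = a i * b i" if "i \<le> n" for i
  proof -
    have "u i + v i = (\<Sum>k=i..<n. a k * b k - a (Suc k) * b (Suc k))"
      unfolding u_def v_def sum.distrib[symmetric] by (rule sum.cong) (auto simp: algebra_simps)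
    then show ?thesis using tele[OF that, of "\<lambda>k. a k * b k"] an by simp
  qed
  \<comment> \<open>Between \<open>i\<close> and \<open>j\<close> the factor \<open>b k\<close> (resp. \<open>a (Suc k)\<close>) is at least \<open>b j\<close> (resp. \<open>a i\<close>);
    with these constants the sum telescopes and the diagonal identity finishes.\<close>
  have feasible: "a i * b j \<le> u i + v j" if ij: "i < n" "j < n" for i j
  proof (cases "i \<le> j")
    case True
    have "u i = (\<Sum>k=i..<j. (a k - a (Suc k)) * b k) + u j"
      unfolding u_def using True ij by (simp add: sum.atLeastLessThan_concat)
    moreover have "(\<Sum>k=i..<j. (a k - a (Suc k)) * b j) \<le> (\<Sum>k=i..<j. (a k - a (Suc k)) * b k)"
      by (rule sum_mono) (auto intro!: mult_left_mono da antimonoD[OF b])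
    moreover have "(\<Sum>k=i..<j. (a k - a (Suc k)) * b j) = (a i - a j) * b j"
      using tele[OF True, of a] by (simp add: sum_distrib_right[symmetric])
    ultimately show ?thesis using diag[of j] ij by (simp add: algebra_simps)
  next
    case False
    then have ji: "j \<le> i" by simp
    have "v j = (\<Sum>k=j..<i. a (Suc k) * (b k - b (Suc k))) + v i"
      unfolding v_def using ji ij by (simp add: sum.atLeastLessThan_concat)
    moreover have "(\<Sum>k=j..<i. a i * (b k - b (Suc k))) \<le> (\<Sum>k=j..<i. a (Suc k) * (b k - b (Suc k)))"
      by (rule sum_mono) (auto intro!: mult_right_mono db antimonoD[OF a])
    moreover have "(\<Sum>k=j..<i. a i * (b k - b (Suc k))) = a i * (b j - b i)"
      using tele[OF ji, of b] by (simp add: sum_distrib_left[symmetric])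
    ultimately show ?thesis using diag[of i] ij by (simp add: algebra_simps)
  qed
  have "(\<Sum>i<n. \<Sum>j<n. W i j * (a i * b j)) \<le> (\<Sum>i<n. \<Sum>j<n. W i j * (u i + v j))"
    by (intro sum_mono mult_left_mono) (auto intro: feasible W)
  also have "\<dots> = (\<Sum>i<n. u i * (\<Sum>j<n. W i j)) + (\<Sum>i<n. \<Sum>j<n. v j * W i j)"
    by (simp add: distrib_left sum.distrib sum_distrib_left mult.commute)
  also have "(\<Sum>i<n. \<Sum>j<n. v j * W i j) = (\<Sum>j<n. v j * (\<Sum>i<n. W i j))"
    by (subst sum.swap) (simp add: sum_distrib_left)
  also have "(\<Sum>i<n. u i * (\<Sum>j<n. W i j)) + (\<Sum>j<n. v j * (\<Sum>i<n. W i j))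
      \<le> (\<Sum>i<n. u i) + (\<Sum>j<n. v j)"
    by (intro add_mono sum_mono) (auto intro!: mult_left_le u0 v0 rows cols)
  also have "\<dots> = (\<Sum>i<n. a i * b i)"
    unfolding sum.distrib[symmetric] by (rule sum.cong) (auto simp: diag)
  finally show ?thesis .
qed

section \<open>Quadratic forms with diagonal blocks\<close>

text \<open>
  Positive semidefiniteness of the block matrix with diagonal blocks \<open>diag l\<close>, \<open>diag m\<close> and
  off-diagonal block \<open>M\<close>. Test vectors are functions restricted by the summation ranges, which
  makes choosing them easier than with vectors of fixed dimension.
\<close>

definition coupled_form_nonneg ::
    "nat \<Rightarrow> nat \<Rightarrow> (nat \<Rightarrow> real) \<Rightarrow> (nat \<Rightarrow> real) \<Rightarrow> (nat \<Rightarrow> nat \<Rightarrow> real) \<Rightarrow> bool" where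
  "coupled_form_nonneg p q l m M \<longleftrightarrow>
     (\<forall>f g. 0 \<le> (\<Sum>i<p. l i * (f i)\<^sup>2) + 2 * (\<Sum>i<p. \<Sum>j<q. f i * M i j * g j) + (\<Sum>j<q. m j * (g j)\<^sup>2))"

lemma coupled_form_cong:
  assumes "\<And>i j. i < p \<Longrightarrow> j < q \<Longrightarrow> M i j = N i j"
  shows "coupled_form_nonneg p q l m M = coupled_form_nonneg p q l m N"
proof -
  have "(\<Sum>i<p. \<Sum>j<q. f i * M i j * g j) = (\<Sum>i<p. \<Sum>j<q. f i * N i j * g j)" for f g
    by (intro sum.cong refl) (simp add: assms)
  then show ?thesis by (simp add: coupled_form_nonneg_def)
qed

lemma coupled_form_swap:
  assumes "coupled_form_nonneg p q l m M"
  shows "coupled_form_nonneg q p m l (\<lambda>j i. M i j)"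
  unfolding coupled_form_nonneg_def
proof (intro allI)
  fix f g :: "nat \<Rightarrow> real"
  have "(\<Sum>i<q. \<Sum>j<p. f i * M j i * g j) = (\<Sum>i<p. \<Sum>j<q. g i * M i j * f j)"
    by (subst sum.swap) (simp add: mult_ac)
  then show "0 \<le> (\<Sum>i<q. m i * (f i)\<^sup>2) + 2 * (\<Sum>i<q. \<Sum>j<p. f i * M j i * g j) + (\<Sum>j<p. l j * (g j)\<^sup>2)"
    using assms[unfolded coupled_form_nonneg_def, rule_format, of g f] by linarith
qed

lemma coupled_form_row:
  assumes F: "coupled_form_nonneg p q l m M" and i: "i < p"
  shows "0 \<le> l i + 2 * (\<Sum>j<q. M i j * g j) + (\<Sum>j<q. m j * (g j)\<^sup>2)"
proof -
  define f where "f k = (if k = i then 1 else 0 :: real)" for k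
  have "(\<Sum>k<p. l k * (f k)\<^sup>2) = (\<Sum>k<p. if k = i then l k else 0)"
    by (rule sum.cong) (auto simp: f_def)
  moreover have "(\<Sum>k<p. \<Sum>j<q. f k * M k j * g j) = (\<Sum>k<p. if k = i then \<Sum>j<q. M k j * g j else 0)"
    by (rule sum.cong) (auto simp: f_def)
  ultimately show ?thesis
    using F[unfolded coupled_form_nonneg_def, rule_format, of f g] i by simp
qed

text \<open>
  If \<open>m j\<close> vanishes, the form is affine in the \<open>j\<close>-th variable of the second group, so a
  nonzero coefficient would let it become negative; \<open>t\<close> makes it equal to \<open>-1\<close>.
\<close>

lemma coupled_form_zero:
  assumes F: "coupled_form_nonneg p q l m M" and "i < p" and j: "j < q" and m: "m j = 0"
  shows "M i j = 0"
proof (rule ccontr)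
  assume M: "M i j \<noteq> 0"
  define t where "t = - (l i + 1) / (2 * M i j)"
  define g where "g k = (if k = j then t else 0)" for k
  have "(\<Sum>k<q. M i k * g k) = (\<Sum>k<q. if k = j then M i k * t else 0)"
    "(\<Sum>k<q. m k * (g k)\<^sup>2) = (\<Sum>k<q. if k = j then m k * t\<^sup>2 else 0)"
    by (rule sum.cong; simp add: g_def)+
  then have "0 \<le> l i + 2 * (M i j * t)"
    using coupled_form_row[OF F \<open>i < p\<close>, of g] j m by simp
  then show False using M by (simp add: t_def field_simps)
qed

text \<open>
  The minimiser of the form for fixed \<open>i\<close> is \<open>g j = - M i j / m j\<close>. Columns with \<open>m j = 0\<close>
  contribute nothing, because division by zero gives zero.
\<close>

lemma coupled_form_row_bound:
  assumes F: "coupled_form_nonneg p q l m M" and "i < p"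
  shows "(\<Sum>j<q. (M i j)\<^sup>2 / m j) \<le> l i"
proof -
  let ?g = "\<lambda>j. - M i j / m j"
  have "m j * (?g j)\<^sup>2 = (M i j)\<^sup>2 / m j" "M i j * ?g j = - ((M i j)\<^sup>2 / m j)" for j
    by (auto simp: power2_eq_square)
  then have "(\<Sum>j<q. m j * (?g j)\<^sup>2) = (\<Sum>j<q. (M i j)\<^sup>2 / m j)"
    "(\<Sum>j<q. M i j * ?g j) = - (\<Sum>j<q. (M i j)\<^sup>2 / m j)"
    by (simp_all only: sum_negf)
  then show ?thesis
    using coupled_form_row[OF F \<open>i < p\<close>, of ?g] by linarith
qed

text \<open>
  Both index ranges are enlarged to a common \<open>n = p + q\<close>, where the weights are square and both
  sequences have reached zero. The weights \<open>W\<close> vanish on the added indices because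
  \<open>l\<close> or \<open>m\<close> does, whatever the values of \<open>M\<close> are there. A vanishing denominator
  inside the original range loses nothing, since \<open>M i j = 0\<close> there.
\<close>

lemma coupled_form_coupling_le:
  assumes F: "coupled_form_nonneg p q l m M"
    and l: "antimono l" "\<And>i. p \<le> i \<Longrightarrow> l i = 0"
    and m: "antimono m" "\<And>j. q \<le> j \<Longrightarrow> m j = 0"
  shows "(\<Sum>i<p. \<Sum>j<q. (M i j)\<^sup>2) \<le> (\<Sum>i<p. l i * m i)"
proof -
  let ?n = "p + q"
  let ?W = "\<lambda>i j. (M i j)\<^sup>2 / (l i * m j)"
  have nonneg: "0 \<le> l i" "0 \<le> m i" for i
    using antimonoD[OF l(1), of i "max i p"] antimonoD[OF m(1), of i "max i q"] l(2) m(2) by auto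
  have cut_p: "(\<Sum>i<?n. h i) = (\<Sum>i<p. h i)" if "\<And>i. p \<le> i \<Longrightarrow> h i = 0" for h :: "nat \<Rightarrow> real"
    by (rule sum.mono_neutral_right) (auto simp: that)
  have cut_q: "(\<Sum>i<?n. h i) = (\<Sum>i<q. h i)" if "\<And>i. q \<le> i \<Longrightarrow> h i = 0" for h :: "nat \<Rightarrow> real"
    by (rule sum.mono_neutral_right) (auto simp: that)
  have rows: "(\<Sum>j<?n. ?W i j) \<le> 1" for i
  proof (cases "l i = 0")
    case False
    then have "i < p" and "0 < l i" using l(2)[of i] nonneg(1)[of i] by linarith+
    have "(\<Sum>j<?n. ?W i j) = (\<Sum>j<q. ?W i j)" by (rule cut_q) (simp add: m(2))
    also have "\<dots> = (\<Sum>j<q. (M i j)\<^sup>2 / m j) / l i"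
      by (simp add: sum_divide_distrib mult.commute)
    also have "\<dots> \<le> 1" using coupled_form_row_bound[OF F \<open>i < p\<close>] \<open>0 < l i\<close> by simp
    finally show ?thesis .
  qed simp
  have cols: "(\<Sum>i<?n. ?W i j) \<le> 1" for j
  proof (cases "m j = 0")
    case False
    then have "j < q" and "0 < m j" using m(2)[of j] nonneg(2)[of j] by linarith+
    have "(\<Sum>i<?n. ?W i j) = (\<Sum>i<p. ?W i j)" by (rule cut_p) (simp add: l(2))
    also have "\<dots> = (\<Sum>i<p. (M i j)\<^sup>2 / l i) / m j"
      by (simp add: sum_divide_distrib)
    also have "\<dots> \<le> 1"
      using coupled_form_row_bound[OF coupled_form_swap[OF F] \<open>j < q\<close>] \<open>0 < m j\<close> by simp
    finally show ?thesis .
  qed simp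
  have entry: "(M i j)\<^sup>2 = ?W i j * (l i * m j)" if "i < p" "j < q" for i j
    using coupled_form_zero[OF F that] coupled_form_zero[OF coupled_form_swap[OF F] that(2,1)]
    by (cases "l i = 0"; cases "m j = 0") simp_all
  have "(\<Sum>i<p. \<Sum>j<q. (M i j)\<^sup>2) = (\<Sum>i<p. \<Sum>j<q. ?W i j * (l i * m j))"
    by (intro sum.cong refl entry) auto
  also have "\<dots> = (\<Sum>i<p. \<Sum>j<?n. ?W i j * (l i * m j))"
    by (intro sum.cong refl cut_q[symmetric]) (simp add: m(2))
  also have "\<dots> = (\<Sum>i<?n. \<Sum>j<?n. ?W i j * (l i * m j))"
    by (rule cut_p[symmetric]) (simp add: l(2))
  also have "\<dots> \<le> (\<Sum>i<?n. l i * m i)"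
    proof (rule substochastic_sum_le)
  qed (use rows cols nonneg l m in \<open>simp_all\<close>)
  also have "\<dots> = (\<Sum>i<p. l i * m i)" by (rule cut_p) (simp add: l(2))
  finally show ?thesis .
qed

text \<open>
  With \<open>F = sqrt (l i) * f i\<close> and \<open>G = sqrt (m i) * g i\<close> each index contributes
  \<open>F\<^sup>2 + 2 * t * F * G + G\<^sup>2 = (1 - t) * (F\<^sup>2 + G\<^sup>2) + t * (F + G)\<^sup>2\<close>.
\<close>

lemma coupled_form_diagonal:
  assumes l: "\<And>i. 0 \<le> l i" "\<And>i. p \<le> i \<Longrightarrow> l i = 0"
    and m: "\<And>j. 0 \<le> m j" "\<And>j. q \<le> j \<Longrightarrow> m j = 0"
    and t: "0 \<le> t" "t \<le> 1"
  shows "coupled_form_nonneg p q l m (\<lambda>i j. if i = j then t * (sqrt (l i) * sqrt (m j)) else 0)"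
  unfolding coupled_form_nonneg_def
proof (intro allI)
  fix f g :: "nat \<Rightarrow> real"
  let ?n = "p + q"
  let ?F = "\<lambda>i. sqrt (l i) * f i" and ?G = "\<lambda>i. sqrt (m i) * g i"
  have F: "(\<Sum>i<p. l i * (f i)\<^sup>2) = (\<Sum>i<?n. (?F i)\<^sup>2)"
    by (rule sum.mono_neutral_cong_left) (auto simp: l power_mult_distrib)
  have G: "(\<Sum>i<q. m i * (g i)\<^sup>2) = (\<Sum>i<?n. (?G i)\<^sup>2)"
    by (rule sum.mono_neutral_cong_left) (auto simp: m power_mult_distrib)
  have "(\<Sum>i<p. \<Sum>j<q. f i * (if i = j then t * (sqrt (l i) * sqrt (m j)) else 0) * g j)
      = (\<Sum>i<p. \<Sum>j<q. if i = j then t * (?F i * ?G j) else 0)"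
    by (intro sum.cong refl) auto
  also have "\<dots> = (\<Sum>i<p. t * (?F i * ?G i))"
    by (rule sum.cong) (auto simp: m)
  also have "\<dots> = (\<Sum>i<?n. t * (?F i * ?G i))"
    by (rule sum.mono_neutral_left) (auto simp: l)
  finally have "(\<Sum>i<p. l i * (f i)\<^sup>2)
      + 2 * (\<Sum>i<p. \<Sum>j<q. f i * (if i = j then t * (sqrt (l i) * sqrt (m j)) else 0) * g j)
      + (\<Sum>j<q. m j * (g j)\<^sup>2)
    = (\<Sum>i<?n. (?F i)\<^sup>2 + 2 * (t * (?F i * ?G i)) + (?G i)\<^sup>2)"
    unfolding F G by (simp only: sum.distrib sum_distrib_left)
  also have "\<dots> = (\<Sum>i<?n. (1 - t) * ((?F i)\<^sup>2 + (?G i)\<^sup>2) + t * (?F i + ?G i)\<^sup>2)"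
    by (rule sum.cong) (auto simp: power2_eq_square algebra_simps)
  also have "\<dots> \<ge> 0"
    using t by (intro sum_nonneg add_nonneg_nonneg mult_nonneg_nonneg) auto
  finally show "0 \<le> (\<Sum>i<p. l i * (f i)\<^sup>2)
      + 2 * (\<Sum>i<p. \<Sum>j<q. f i * (if i = j then t * (sqrt (l i) * sqrt (m j)) else 0) * g j)
      + (\<Sum>j<q. m j * (g j)\<^sup>2)" .
qed


section \<open>Traces and quadratic forms under orthogonal changes of basis\<close>
lemma mat_trace_mult_comm:
  fixes A B :: "'a :: comm_semiring_0 mat"
  assumes A: "A \<in> carrier_mat n m" and B: "B \<in> carrier_mat m n"
  shows "mat_trace (A * B) = mat_trace (B * A)"
proof -
  have "mat_trace (A * B) = (\<Sum>i<n. \<Sum>j<m. A $$ (i,j) * B $$ (j,i))"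
    using A B by (simp add: mat_trace_def scalar_prod_def atLeast0LessThan)
  also have "\<dots> = (\<Sum>j<m. \<Sum>i<n. B $$ (j,i) * A $$ (i,j))"
    by (subst sum.swap) (simp add: mult.commute)
  also have "\<dots> = mat_trace (B * A)"
    using A B by (simp add: mat_trace_def scalar_prod_def atLeast0LessThan)
  finally show ?thesis .
qed

lemma mat_trace_gram:
  fixes A :: "real mat"
  assumes A: "A \<in> carrier_mat n m"
  shows "mat_trace (A * A\<^sup>T) = (\<Sum>i<n. \<Sum>j<m. (A $$ (i,j))\<^sup>2)"
  using A by (simp add: mat_trace_def scalar_prod_def atLeast0LessThan power2_eq_square)

lemma mat_trace_gram_orthogonal:
  fixes B U V :: "real mat"
  assumes B: "B \<in> carrier_mat n m" and U: "U \<in> carrier_mat n n" and V: "V \<in> carrier_mat m m"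
    and UU: "U\<^sup>T * U = 1\<^sub>m n" and VV: "V\<^sup>T * V = 1\<^sub>m m"
  shows "mat_trace ((U * B * V\<^sup>T) * (U * B * V\<^sup>T)\<^sup>T) = mat_trace (B * B\<^sup>T)"
proof -
  have T: "(U * B * V\<^sup>T)\<^sup>T = V * B\<^sup>T * U\<^sup>T"
    using B U V by (simp add: transpose_mult[of _ n m _ m] transpose_mult[of _ n n _ m])
  have "(U * B * V\<^sup>T) * (V * B\<^sup>T * U\<^sup>T) = U * B * (V\<^sup>T * V) * B\<^sup>T * U\<^sup>T"
    using B U V by (simp add: assoc_mult_mat[of _ n n _ m _ n] assoc_mult_mat[of _ n m _ m _ m]
      assoc_mult_mat[of _ n n _ m _ m] assoc_mult_mat[of _ n n _ n _ n] assoc_mult_mat[of _ n m _ n _ n]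
      assoc_mult_mat[of _ m m _ n _ n] assoc_mult_mat[of _ m m _ m _ n]
      assoc_mult_mat[of _ n m _ m _ n])
  also have "\<dots> = U * (B * B\<^sup>T * U\<^sup>T)"
    using B U V by (simp add: VV assoc_mult_mat[of _ n n _ m _ n] assoc_mult_mat[of _ n n _ n _ n]
      assoc_mult_mat[of _ n m _ n _ n])
  finally have "mat_trace ((U * B * V\<^sup>T) * (U * B * V\<^sup>T)\<^sup>T) = mat_trace (U * (B * B\<^sup>T * U\<^sup>T))"
    by (simp add: T)
  also have "\<dots> = mat_trace (B * B\<^sup>T * U\<^sup>T * U)"
    by (rule mat_trace_mult_comm[of _ n n]) (use B U in auto)
  also have "B * B\<^sup>T * U\<^sup>T * U = B * B\<^sup>T"
    using B U UU by (simp add: assoc_mult_mat[of _ n n _ n _ n] assoc_mult_mat[of _ n m _ n _ n]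
      assoc_mult_mat[of _ m n _ n _ n])
  finally show ?thesis .
qed

lemma scalar_prod_mat_index:
  fixes A :: "real mat"
  assumes "A \<in> carrier_mat n m" "x \<in> carrier_vec n" "y \<in> carrier_vec m"
  shows "x \<bullet> (A *\<^sub>v y) = (\<Sum>i<n. \<Sum>j<m. x $ i * A $$ (i,j) * y $ j)"
  using assms by (simp add: scalar_prod_def atLeast0LessThan sum_distrib_left mult.assoc)

lemma scalar_prod_change_basis:
  fixes A U V :: "real mat"
  assumes A: "A \<in> carrier_mat n m" and U: "U \<in> carrier_mat n n" and V: "V \<in> carrier_mat m m"
    and x: "x \<in> carrier_vec n" and y: "y \<in> carrier_vec m"
  shows "(U *\<^sub>v x) \<bullet> (A *\<^sub>v (V *\<^sub>v y)) = x \<bullet> ((U\<^sup>T * A * V) *\<^sub>v y)"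
proof -
  have "(U\<^sup>T * A * V) *\<^sub>v y = U\<^sup>T *\<^sub>v (A *\<^sub>v (V *\<^sub>v y))"
    using assms by (simp add: assoc_mult_mat_vec[of _ n m _ m] assoc_mult_mat_vec[of _ n n _ m])
  moreover have "A *\<^sub>v (V *\<^sub>v y) \<in> carrier_vec n" using A V y by simp
  ultimately show ?thesis
    using transpose_vec_mult_scalar[of "U\<^sup>T" n n "A *\<^sub>v (V *\<^sub>v y)" x] U x by simp
qed

lemma quadratic_form_mat_diag:
  fixes l :: "nat \<Rightarrow> real"
  assumes x: "x \<in> carrier_vec n"
  shows "x \<bullet> (mat_diag n l *\<^sub>v x) = (\<Sum>i<n. l i * (x $ i)\<^sup>2)"
proof -
  have "x \<bullet> (mat_diag n l *\<^sub>v x) = (\<Sum>i<n. \<Sum>j<n. x $ i * mat_diag n l $$ (i, j) * x $ j)"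
    by (rule scalar_prod_mat_index) (use x in auto)
  also have "\<dots> = (\<Sum>i<n. \<Sum>j<n. if i = j then l i * (x $ i)\<^sup>2 else 0)"
    by (intro sum.cong refl) (simp add: mat_diag_def power2_eq_square)
  finally show ?thesis by simp
qed

section \<open>Eigenvalues of positive semidefinite matrices\<close>
lemma psd_matsD:
  assumes "A \<in> psd_mats m"
  shows "A \<in> carrier_mat m m" "A\<^sup>T = A" "v \<in> carrier_vec m \<Longrightarrow> 0 \<le> v \<bullet> (A *\<^sub>v v)"
  using assms by (auto simp: psd_mats_def)

lemma eigendecompositionD:
  assumes "eigendecomposition m A U"
  shows "U \<in> carrier_mat m m" "U * U\<^sup>T = 1\<^sub>m m" "U\<^sup>T * U = 1\<^sub>m m"
    "A \<in> carrier_mat m m" "A = U * mat_diag m (eigval A) * U\<^sup>T"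
    "U\<^sup>T * A * U = mat_diag m (eigval A)"
proof -
  show U: "U \<in> carrier_mat m m" and UU: "U * U\<^sup>T = 1\<^sub>m m" "U\<^sup>T * U = 1\<^sub>m m"
    and A: "A = U * mat_diag m (eigval A) * U\<^sup>T"
    using assms by (auto simp: eigendecomposition_def)
  let ?D = "mat_diag m (eigval A)"
  have D: "?D \<in> carrier_mat m m" by simp
  show "A \<in> carrier_mat m m" by (subst A) (use U in auto)
  have "U\<^sup>T * (U * ?D * U\<^sup>T) * U = (U\<^sup>T * U) * ?D * (U\<^sup>T * U)"
    using U D by (simp add: assoc_mult_mat[of _ m m _ m _ m] del: mat_diag_dim)
  also have "\<dots> = ?D" using D by (simp add: UU del: mat_diag_dim)
  finally show "U\<^sup>T * A * U = ?D" using A by simp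
qed

text \<open>The characteristic polynomial has degree \<open>m\<close>, hence at most \<open>m\<close> roots.\<close>

lemma eigval_beyond:
  assumes A: "A \<in> carrier_mat m m" and "m \<le> j"
  shows "eigval A j = 0"
proof -
  have "length (eigenvalues_decreasing A) = size (proots (char_poly A))"
    by (simp add: eigenvalues_decreasing_def flip: size_mset)
  also have "\<dots> \<le> m"
    using size_proots_le[of "char_poly A"] degree_monic_char_poly[OF A] by simp
  finally show ?thesis using \<open>m \<le> j\<close> by (simp add: eigval_def)
qed

text \<open>The \<open>j\<close>-th eigenvalue is the value of the quadratic form at the \<open>j\<close>-th column of \<open>U\<close>.\<close>

lemma eigval_nonneg:
  assumes A: "A \<in> psd_mats m" and E: "eigendecomposition m A U"
  shows "0 \<le> eigval A j"
proof (cases "j < m")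
  case True
  note D = eigendecompositionD[OF E]
  have "0 \<le> (U *\<^sub>v unit_vec m j) \<bullet> (A *\<^sub>v (U *\<^sub>v unit_vec m j))"
    using D(1) by (intro psd_matsD(3)[OF A]) simp
  also have "\<dots> = unit_vec m j \<bullet> (mat_diag m (eigval A) *\<^sub>v unit_vec m j)"
    using scalar_prod_change_basis[OF D(4,1,1)] by (simp add: D(6))
  also have "\<dots> = (\<Sum>i<m. if i = j then eigval A i else 0)"
    unfolding quadratic_form_mat_diag[OF unit_vec_carrier] by (rule sum.cong) (use True in auto)
  also have "\<dots> = eigval A j" using True by simp
  finally show ?thesis .
next
  case False
  then show ?thesis using eigval_beyond[of A m j] psd_matsD(1)[OF A] by simp
qed

text \<open>
  Nonnegativity matters at the end of the list only: there the sequence continues with \<open>0\<close>.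
\<close>

lemma eigval_antimono:
  assumes nonneg: "\<And>j. 0 \<le> eigval A j"
  shows "antimono (eigval A)"
proof (rule antimonoI)
  fix i j :: nat assume "i \<le> j"
  have "sorted (rev (eigenvalues_decreasing A))"
    by (simp add: eigenvalues_decreasing_def)
  then have "j < length (eigenvalues_decreasing A) \<Longrightarrow>
      eigenvalues_decreasing A ! j \<le> eigenvalues_decreasing A ! i"
    using \<open>i \<le> j\<close> by (simp add: sorted_rev_iff_nth_mono)
  then show "eigval A j \<le> eigval A i"
    using \<open>i \<le> j\<close> nonneg[of i] by (auto simp: eigval_def)
qed

lemma mat_trace_square_eigval:
  assumes A: "A\<^sup>T = A" and E: "eigendecomposition m A U"
  shows "mat_trace (A ^\<^sub>m 2) = (\<Sum>i<m. (eigval A i)\<^sup>2)"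
proof -
  note a = eigendecompositionD[OF E]
  let ?D = "mat_diag m (eigval A)"
  have "A ^\<^sub>m 2 = A * A\<^sup>T"
    using a(4) by (simp add: numeral_2_eq_2 A)
  also have "mat_trace \<dots> = mat_trace (?D * ?D\<^sup>T)"
    using mat_trace_gram_orthogonal[OF mat_diag_dim a(1,1,3,3), of "eigval A"]
    by (simp only: a(5)[symmetric])
  also have "\<dots> = (\<Sum>i<m. \<Sum>j<m. if i = j then (eigval A i)\<^sup>2 else 0)"
    unfolding mat_trace_gram[OF mat_diag_dim] by (intro sum.cong refl) (simp add: mat_diag_def)
  finally show ?thesis by simp
qed

lemma eigval_0_pos:
  assumes A: "A \<in> psd_mats m" and E: "eigendecomposition m A U" and nz: "A \<noteq> 0\<^sub>m m m"
  shows "0 < eigval A 0"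
proof (rule ccontr)
  note nonneg = eigval_nonneg[OF A E]
  assume "\<not> 0 < eigval A 0"
  then have "eigval A j = 0" for j
    using antimonoD[OF eigval_antimono, of A 0 j] nonneg nonneg[of j] by fastforce
  then have "mat_diag m (eigval A) = 0\<^sub>m m m" by (auto simp: mat_diag_def)
  then have "U * mat_diag m (eigval A) * U\<^sup>T = 0\<^sub>m m m"
    using eigendecompositionD(1)[OF E] by simp
  then show False using nz eigendecompositionD(5)[OF E] by simp
qed

section \<open>Block matrices in eigencoordinates\<close>
lemma psd_four_block_mat_iff:
  fixes A B D :: "real mat"
  assumes A: "A \<in> carrier_mat p p" "A\<^sup>T = A" and D: "D \<in> carrier_mat q q" "D\<^sup>T = D"
    and B: "B \<in> carrier_mat p q"
  shows "four_block_mat A B B\<^sup>T D \<in> psd_mats (p + q) \<longleftrightarrow>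
    (\<forall>x \<in> carrier_vec p. \<forall>y \<in> carrier_vec q.
      0 \<le> x \<bullet> (A *\<^sub>v x) + 2 * (x \<bullet> (B *\<^sub>v y)) + y \<bullet> (D *\<^sub>v y))"
proof -
  let ?S = "four_block_mat A B B\<^sup>T D"
  have BT: "B\<^sup>T \<in> carrier_mat q p" using B by simp
  have form: "(x @\<^sub>v y) \<bullet> (?S *\<^sub>v (x @\<^sub>v y))
      = x \<bullet> (A *\<^sub>v x) + 2 * (x \<bullet> (B *\<^sub>v y)) + y \<bullet> (D *\<^sub>v y)"
    if x: "x \<in> carrier_vec p" and y: "y \<in> carrier_vec q" for x y
  proof -
    have c: "A *\<^sub>v x \<in> carrier_vec p" "B *\<^sub>v y \<in> carrier_vec p"
      "B\<^sup>T *\<^sub>v x \<in> carrier_vec q" "D *\<^sub>v y \<in> carrier_vec q"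
      using A B D x y by auto
    have "y \<bullet> (B\<^sup>T *\<^sub>v x) = x \<bullet> (B *\<^sub>v y)"
      using transpose_vec_mult_scalar[OF B y x] comm_scalar_prod[OF c(3) y] by simp
    then show ?thesis
      using four_block_mat_mult_vec[OF A(1) B BT D(1) x y] c x y
      by (simp add: scalar_prod_append[of _ p _ q] scalar_prod_add_distrib[of _ p]
          scalar_prod_add_distrib[of _ q])
  qed
  have "?S\<^sup>T = ?S"
    using transpose_four_block_mat[OF A(1) B BT D(1)] A D by simp
  moreover have "?S \<in> carrier_mat (p + q) (p + q)" using A D by simp
  ultimately have "?S \<in> psd_mats (p + q) \<longleftrightarrow>
      (\<forall>v \<in> carrier_vec (p + q). 0 \<le> v \<bullet> (?S *\<^sub>v v))"
    by (simp add: psd_mats_def)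
  then show ?thesis unfolding all_vec_append by (simp add: form)
qed

text \<open>
  Substituting \<open>U x\<close> and \<open>V y\<close> for the two vectors diagonalises both diagonal blocks and loses no
  test vectors, as \<open>U\<close> and \<open>V\<close> are invertible.
\<close>

lemma psd_four_block_iff_coupled_form:
  assumes A: "A\<^sup>T = A" "eigendecomposition p A U" and D: "D\<^sup>T = D" "eigendecomposition q D V"
    and B: "B \<in> carrier_mat p q"
  shows "four_block_mat A B B\<^sup>T D \<in> psd_mats (p + q) \<longleftrightarrow>
    coupled_form_nonneg p q (eigval A) (eigval D) (\<lambda>i j. (U\<^sup>T * B * V) $$ (i, j))"
proof -
  note a = eigendecompositionD[OF A(2)] and d = eigendecompositionD[OF D(2)]
  let ?M = "U\<^sup>T * B * V"
  let ?Q = "\<lambda>x y. x \<bullet> (A *\<^sub>v x) + 2 * (x \<bullet> (B *\<^sub>v y)) + y \<bullet> (D *\<^sub>v y)"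
  let ?C = "\<lambda>f g. (\<Sum>i<p. eigval A i * (f i)\<^sup>2) + 2 * (\<Sum>i<p. \<Sum>j<q. f i * ?M $$ (i, j) * g j)
    + (\<Sum>j<q. eigval D j * (g j)\<^sup>2)"
  have M: "?M \<in> carrier_mat p q" using a(1) d(1) B by auto
  have form: "?Q (U *\<^sub>v x) (V *\<^sub>v y) = ?C (\<lambda>i. x $ i) (\<lambda>j. y $ j)"
    if x: "x \<in> carrier_vec p" and y: "y \<in> carrier_vec q" for x y
    unfolding scalar_prod_change_basis[OF a(4,1,1) x x] scalar_prod_change_basis[OF B a(1) d(1) x y]
      scalar_prod_change_basis[OF d(4,1,1) y y] a(6) d(6)
      quadratic_form_mat_diag[OF x] quadratic_form_mat_diag[OF y] scalar_prod_mat_index[OF M x y] ..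
  have "(\<forall>x \<in> carrier_vec p. \<forall>y \<in> carrier_vec q. 0 \<le> ?Q x y) \<longleftrightarrow> (\<forall>f g. 0 \<le> ?C f g)"
  proof (intro iffI ballI allI)
    fix f g assume "\<forall>x \<in> carrier_vec p. \<forall>y \<in> carrier_vec q. 0 \<le> ?Q x y"
    then have "0 \<le> ?Q (U *\<^sub>v vec p f) (V *\<^sub>v vec q g)" using a(1) d(1) by simp
    then show "0 \<le> ?C f g" using form[of "vec p f" "vec q g"] by simp
  next
    fix x y :: "real vec"
    assume C: "\<forall>f g. 0 \<le> ?C f g" and x: "x \<in> carrier_vec p" and y: "y \<in> carrier_vec q"
    have "U *\<^sub>v (U\<^sup>T *\<^sub>v x) = x" "V *\<^sub>v (V\<^sup>T *\<^sub>v y) = y"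
      using a(1,2) d(1,2) x y assoc_mult_mat_vec[OF a(1) _ x, of "U\<^sup>T"]
        assoc_mult_mat_vec[OF d(1) _ y, of "V\<^sup>T"] by simp_all
    moreover have "U\<^sup>T *\<^sub>v x \<in> carrier_vec p" "V\<^sup>T *\<^sub>v y \<in> carrier_vec q"
      using a(1) d(1) x y by auto
    ultimately show "0 \<le> ?Q x y"
      using form[of "U\<^sup>T *\<^sub>v x" "V\<^sup>T *\<^sub>v y"] C by simp
  qed
  then show ?thesis
    unfolding psd_four_block_mat_iff[OF a(4) A(1) d(4) D(1) B] coupled_form_nonneg_def .
qed

lemma blocks_four_block_mat:
  assumes "A \<in> carrier_mat p p" "B \<in> carrier_mat p q" "C \<in> carrier_mat q p" "D \<in> carrier_mat q q"
  shows "upper_left_block p p (four_block_mat A B C D) = A"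
    "cross_block p (four_block_mat A B C D) = B"
    "lower_right_block p p (four_block_mat A B C D) = D"
  using assms
  by (auto simp: upper_left_block_def upper_right_block_def lower_right_block_def split_block_def
      Let_def intro!: eq_matI)

lemma Gamma_set_eq_four_block:
  assumes S: "S \<in> Gamma_set p q S1 S2"
  shows "cross_block p S \<in> carrier_mat p q"
    "S = four_block_mat S1 (cross_block p S) (cross_block p S)\<^sup>T S2"
proof -
  have c: "S \<in> carrier_mat (p + q) (p + q)" and sym: "S\<^sup>T = S"
    and S12: "upper_left_block p p S = S1" "lower_right_block p p S = S2"
    using S by (auto simp: Gamma_set_def psd_mats_def)
  obtain A B C D where sp: "split_block S p p = (A, B, C, D)"
    by (cases "split_block S p p")
  have AD: "A = S1" "D = S2" "cross_block p S = B"
    using sp S12 by (auto simp: upper_left_block_def upper_right_block_def lower_right_block_def)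
  note blk = split_block[OF sp, of q q]
  have car: "A \<in> carrier_mat p p" "B \<in> carrier_mat p q" "C \<in> carrier_mat q p" "D \<in> carrier_mat q q"
    and Seq: "S = four_block_mat A B C D"
    using blk c by auto
  have "C = B\<^sup>T"
  proof (rule eq_matI)
    fix i j assume "i < dim_row B\<^sup>T" "j < dim_col B\<^sup>T"
    then have ij: "i < q" "j < p" using car by auto
    have "C $$ (i, j) = S $$ (p + i, j)" using ij car by (simp add: Seq)
    also have "\<dots> = S\<^sup>T $$ (p + i, j)" by (simp add: sym)
    also have "\<dots> = S $$ (j, p + i)" using ij c by simp
    also have "\<dots> = B\<^sup>T $$ (i, j)" using ij car by (simp add: Seq)
    finally show "C $$ (i, j) = B\<^sup>T $$ (i, j)" .
  qed (use car in auto)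
  then show "cross_block p S \<in> carrier_mat p q"
    "S = four_block_mat S1 (cross_block p S) (cross_block p S)\<^sup>T S2"
    using car Seq AD by auto
qed


section \<open>The maximal coupling\<close>
lemma Psi_m_eq:
  assumes U1: "U1 \<in> carrier_mat p p" and U2: "U2 \<in> carrier_mat q q"
  shows "Psi_m p q S1 U1 S2 U2 =
    U1 * mat p q (\<lambda>(i, j). if i = j then sqrt (eigval S1 i) * sqrt (eigval S2 j) else 0) * U2\<^sup>T"
proof -
  let ?D1 = "mat_diag p (\<lambda>j. sqrt (eigval S1 j))" and ?D2 = "mat_diag q (\<lambda>j. sqrt (eigval S2 j))"
  let ?P = "upper_left_block p q (1\<^sub>m (p + q)) :: real mat"
  have P: "?P = mat p q (\<lambda>(i, j). if i = j then 1 else 0)"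
    by (auto simp: upper_left_block_def split_block_def Let_def)
  then have Pc: "?P \<in> carrier_mat p q" by simp
  have "?D1 * ?P * ?D2 = mat p q (\<lambda>(i, j). if i = j then sqrt (eigval S1 i) * sqrt (eigval S2 j) else 0)"
    unfolding mat_diag_mult_left[OF Pc]
    by (subst mat_diag_mult_right[of _ p q]) (auto simp: P intro!: eq_matI)
  moreover have "U1 * ?D1 * ?P * ?D2 = U1 * (?D1 * ?P * ?D2)"
    using U1 Pc mult_carrier_mat[OF mat_diag_dim Pc]
    by (simp add: assoc_mult_mat[of _ p p _ p _ q] assoc_mult_mat[of _ p p _ q _ q])
  ultimately show ?thesis by (simp add: Psi_m_def)
qed

lemma cross_trace_le:
  assumes S: "S \<in> Gamma_set p q S1 S2" and S1: "S1 \<in> psd_mats p" and S2: "S2 \<in> psd_mats q"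
    and E1: "eigendecomposition p S1 U1" and E2: "eigendecomposition q S2 U2"
  shows "mat_trace (cross_block p S * (cross_block p S)\<^sup>T) \<le> (\<Sum>j<p. eigval S1 j * eigval S2 j)"
proof -
  note a = eigendecompositionD[OF E1] and d = eigendecompositionD[OF E2]
  let ?B = "cross_block p S" and ?M = "U1\<^sup>T * cross_block p S * U2"
  note B = Gamma_set_eq_four_block[OF S]
  have M: "?M \<in> carrier_mat p q" using a(1) d(1) B(1) by auto
  have "S \<in> psd_mats (p + q)" using S by (simp add: Gamma_set_def)
  with B(2) have "four_block_mat S1 ?B ?B\<^sup>T S2 \<in> psd_mats (p + q)" by simp
  then have F: "coupled_form_nonneg p q (eigval S1) (eigval S2) (\<lambda>i j. ?M $$ (i, j))"
    using psd_four_block_iff_coupled_form[OF psd_matsD(2)[OF S1] E1 psd_matsD(2)[OF S2] E2 B(1)]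
    by simp
  have "mat_trace (?B * ?B\<^sup>T) = mat_trace (?M * ?M\<^sup>T)"
    using mat_trace_gram_orthogonal[OF B(1), of "U1\<^sup>T" "U2\<^sup>T"] a(1,2) d(1,2) by simp
  also have "\<dots> = (\<Sum>i<p. \<Sum>j<q. (?M $$ (i, j))\<^sup>2)" by (rule mat_trace_gram[OF M])
  also have "\<dots> \<le> (\<Sum>j<p. eigval S1 j * eigval S2 j)"
    by (rule coupled_form_coupling_le[OF F])
      (auto intro!: eigval_antimono eigval_nonneg[OF S1 E1] eigval_nonneg[OF S2 E2]
        eigval_beyond[OF a(4)] eigval_beyond[OF d(4)])
  finally show ?thesis .
qed

lemma Psi_m_trace:
  assumes S1: "S1 \<in> psd_mats p" and S2: "S2 \<in> psd_mats q"
    and E1: "eigendecomposition p S1 U1" and E2: "eigendecomposition q S2 U2"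
  shows "mat_trace (Psi_m p q S1 U1 S2 U2 * (Psi_m p q S1 U1 S2 U2)\<^sup>T)
    = (\<Sum>j<p. eigval S1 j * eigval S2 j)"
proof -
  note a = eigendecompositionD[OF E1] and d = eigendecompositionD[OF E2]
  let ?N = "mat p q (\<lambda>(i, j). if i = j then sqrt (eigval S1 i) * sqrt (eigval S2 j) else 0)"
  have "mat_trace (Psi_m p q S1 U1 S2 U2 * (Psi_m p q S1 U1 S2 U2)\<^sup>T) = mat_trace (?N * ?N\<^sup>T)"
    unfolding Psi_m_eq[OF a(1) d(1)] by (rule mat_trace_gram_orthogonal) (use a(1,3) d(1,3) in auto)
  also have "\<dots> = (\<Sum>i<p. \<Sum>j<q. (?N $$ (i, j))\<^sup>2)" by (rule mat_trace_gram) simp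
  also have "\<dots> = (\<Sum>i<p. \<Sum>j<q. if i = j then eigval S1 i * eigval S2 j else 0)"
    by (intro sum.cong refl)
      (auto simp: power_mult_distrib eigval_nonneg[OF S1 E1] eigval_nonneg[OF S2 E2])
  also have "\<dots> = (\<Sum>j<p. eigval S1 j * eigval S2 j)"
    by (rule sum.cong) (auto simp: eigval_beyond[OF d(4)])
  finally show ?thesis .
qed

lemma scaled_Psi_m_in_Gamma_set:
  assumes S1: "S1 \<in> psd_mats p" and S2: "S2 \<in> psd_mats q"
    and E1: "eigendecomposition p S1 U1" and E2: "eigendecomposition q S2 U2"
    and t: "0 \<le> t" "t \<le> 1"
  shows "four_block_mat S1 (t \<cdot>\<^sub>m Psi_m p q S1 U1 S2 U2) (t \<cdot>\<^sub>m Psi_m p q S1 U1 S2 U2)\<^sup>T S2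
    \<in> Gamma_set p q S1 S2"
proof -
  note a = eigendecompositionD[OF E1] and d = eigendecompositionD[OF E2]
  let ?N = "mat p q (\<lambda>(i, j). if i = j then sqrt (eigval S1 i) * sqrt (eigval S2 j) else 0)"
  let ?B = "t \<cdot>\<^sub>m Psi_m p q S1 U1 S2 U2"
  have N: "?N \<in> carrier_mat p q" by simp
  have "U1\<^sup>T * (U1 * ?N * U2\<^sup>T) * U2 = (U1\<^sup>T * U1) * ?N * (U2\<^sup>T * U2)"
    using a(1) d(1) N by (simp add: assoc_mult_mat[of _ p p _ q _ q] assoc_mult_mat[of _ p p _ p _ q]
        assoc_mult_mat[of _ p q _ q _ q] del: mat_carrier)
  also have "\<dots> = ?N" by (simp add: a(3) d(3))
  finally have N': "U1\<^sup>T * (U1 * ?N * U2\<^sup>T) * U2 = ?N" .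
  have c: "U1 * ?N * U2\<^sup>T \<in> carrier_mat p q" "U1\<^sup>T * (U1 * ?N * U2\<^sup>T) \<in> carrier_mat p q"
    using a(1) d(1) by auto
  have B: "?B \<in> carrier_mat p q" using c(1) by (simp only: Psi_m_eq[OF a(1) d(1)] smult_carrier_mat)
  have "U1\<^sup>T * ?B * U2 = t \<cdot>\<^sub>m (U1\<^sup>T * (U1 * ?N * U2\<^sup>T) * U2)"
    unfolding Psi_m_eq[OF a(1) d(1)]
    using mult_smult_distrib[of "U1\<^sup>T" p p _ q t, OF _ c(1)] a(1)
      mult_smult_assoc_mat[OF c(2) d(1), of t] by simp
  then have M: "U1\<^sup>T * ?B * U2 = t \<cdot>\<^sub>m ?N" by (simp only: N')
  have "coupled_form_nonneg p q (eigval S1) (eigval S2)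
      (\<lambda>i j. if i = j then t * (sqrt (eigval S1 i) * sqrt (eigval S2 j)) else 0)"
    by (rule coupled_form_diagonal)
      (use t eigval_nonneg[OF S1 E1] eigval_nonneg[OF S2 E2] eigval_beyond[OF a(4)]
        eigval_beyond[OF d(4)] in auto)
  also have "?this \<longleftrightarrow> coupled_form_nonneg p q (eigval S1) (eigval S2) (\<lambda>i j. (U1\<^sup>T * ?B * U2) $$ (i, j))"
    unfolding M by (rule coupled_form_cong) auto
  finally have "four_block_mat S1 ?B ?B\<^sup>T S2 \<in> psd_mats (p + q)"
    using psd_four_block_iff_coupled_form[OF psd_matsD(2)[OF S1] E1 psd_matsD(2)[OF S2] E2 B]
    by simp
  then show ?thesis
    using blocks_four_block_mat[OF a(4) B _ d(4), of "?B\<^sup>T"] B by (simp add: Gamma_set_def)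
qed

theorem mainTheorem4:
  fixes p q :: nat and S1 S2 U1 U2 :: "real mat"
  assumes "p \<ge> 1" and "q \<ge> 1"
    and "S1 \<in> psd_mats p" and "S2 \<in> psd_mats q"
    and "S1 \<noteq> 0\<^sub>m p p" and "S2 \<noteq> 0\<^sub>m q q"
    and "eigendecomposition p S1 U1" and "eigendecomposition q S2 U2"
  defines "Psim \<equiv> Psi_m p q S1 U1 S2 U2"
    and "Sigmam \<equiv> Sigma_m p q S1 U1 S2 U2"
    and "Gam \<equiv> Gamma_set p q S1 S2"
    and "RVbar \<equiv> RV_adj p q S1 U1 S2 U2"
  shows "mat_trace (Psim * Psim\<^sup>T) = (\<Sum>j < p. eigval S1 j * eigval S2 j)
    \<and> Sigmam \<in> Gam
    \<and> (\<forall>S \<in> Gam. mat_trace (cross_block p S * (cross_block p S)\<^sup>T) \<le> mat_trace (Psim * Psim\<^sup>T))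
    \<and> (\<forall>S \<in> Gam. RVbar S =
          mat_trace (cross_block p S * (cross_block p S)\<^sup>T) / mat_trace (Psim * Psim\<^sup>T))
    \<and> (\<forall>S \<in> Gam. 0 \<le> RV p S \<and> RV p S \<le> RVbar S \<and> RVbar S \<le> 1)
    \<and> (\<forall>r \<in> {0..1}. \<exists>S \<in> Gam. RVbar S = r)"
proof -
  note S1 = assms(3) and S2 = assms(4) and E1 = assms(7) and E2 = assms(8)
  note a = eigendecompositionD[OF E1] and d = eigendecompositionD[OF E2]
  note nonneg = eigval_nonneg[OF S1 E1] eigval_nonneg[OF S2 E2]
  let ?l = "eigval S1" and ?m = "eigval S2"
  let ?n = "p + q"
  let ?T = "\<lambda>S. mat_trace (cross_block p S * (cross_block p S)\<^sup>T)"
  define K where "K = mat_trace (Psim * Psim\<^sup>T)"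
  define c where "c = sqrt (mat_trace (S1 ^\<^sub>m 2) * mat_trace (S2 ^\<^sub>m 2))"
  have K: "K = (\<Sum>j<p. ?l j * ?m j)"
    unfolding K_def Psim_def by (rule Psi_m_trace[OF S1 S2 E1 E2])
  have Psim: "Psim \<in> carrier_mat p q" unfolding Psim_def Psi_m_eq[OF a(1) d(1)] using a(1) d(1) by auto
  have unit: "1 \<cdot>\<^sub>m A = A" for A :: "real mat" by (rule eq_matI) auto
  have Sigmam: "Sigmam \<in> Gam"
    using scaled_Psi_m_in_Gamma_set[OF S1 S2 E1 E2, of 1]
    by (simp add: Sigmam_def Sigma_m_def Gam_def unit)
  have max: "?T S \<le> K" if "S \<in> Gam" for S
    using cross_trace_le[OF _ S1 S2 E1 E2] that by (simp add: K Gam_def)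
  have pos: "0 < ?l 0" "0 < ?m 0"
    using eigval_0_pos[OF S1 E1] eigval_0_pos[OF S2 E2] assms(5,6) by auto
  have "?l 0 * ?m 0 \<le> K"
    unfolding K by (rule member_le_sum) (use assms(1) nonneg in auto)
  then have K0: "0 < K" using mult_pos_pos[OF pos] by linarith
  have K_le_c: "K \<le> c"
  proof -
    have "K = (\<Sum>j<?n. \<bar>?l j\<bar> * \<bar>?m j\<bar>)"
      unfolding K by (rule sum.mono_neutral_cong_left) (auto simp: nonneg eigval_beyond[OF a(4)])
    also have "\<dots> \<le> L2_set ?l {..<?n} * L2_set ?m {..<?n}" by (rule L2_set_mult_ineq)
    also have "(\<Sum>j<?n. (?l j)\<^sup>2) = (\<Sum>j<p. (?l j)\<^sup>2)"
      by (rule sum.mono_neutral_right) (auto simp: eigval_beyond[OF a(4)])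
    then have "L2_set ?l {..<?n} = sqrt (mat_trace (S1 ^\<^sub>m 2))"
      using mat_trace_square_eigval[OF psd_matsD(2)[OF S1] E1] by (simp add: L2_set_def)
    moreover have "(\<Sum>j<?n. (?m j)\<^sup>2) = (\<Sum>j<q. (?m j)\<^sup>2)"
      by (rule sum.mono_neutral_right) (auto simp: eigval_beyond[OF d(4)])
    then have "L2_set ?m {..<?n} = sqrt (mat_trace (S2 ^\<^sub>m 2))"
      using mat_trace_square_eigval[OF psd_matsD(2)[OF S2] E2] by (simp add: L2_set_def)
    ultimately show ?thesis by (simp add: c_def real_sqrt_mult)
  qed
  then have c0: "0 < c" using K0 by linarith
  have RV: "RV p S = ?T S / c" if "S \<in> Gam" for S
    using that by (simp add: RV_def c_def Gam_def Gamma_set_def)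
  have "cross_block p Sigmam = Psim"
    unfolding Sigmam_def Sigma_m_def Psim_def[symmetric]
    by (rule blocks_four_block_mat[OF a(4) Psim _ d(4)]) (use Psim in simp)
  then have "RV p Sigmam = K / c" using RV[OF Sigmam] by (simp add: K_def)
  then have RVbar: "RVbar S = ?T S / K" if "S \<in> Gam" for S
    using RV[OF that] c0 by (simp add: RVbar_def RV_adj_def Sigmam_def)
  have T0: "0 \<le> ?T S" if "S \<in> Gam" for S
    using that Gamma_set_eq_four_block(1)[of S p q S1 S2]
    by (subst mat_trace_gram[of _ p q]) (auto simp: Gam_def intro!: sum_nonneg)
  have bounds: "0 \<le> RV p S \<and> RV p S \<le> RVbar S \<and> RVbar S \<le> 1" if S: "S \<in> Gam" for S
    unfolding RV[OF S] RVbar[OF S]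
    using T0[OF S] max[OF S] K0 c0 K_le_c by (simp add: divide_left_mono)
  have attained: "\<exists>S \<in> Gam. RVbar S = r" if r: "r \<in> {0..1}" for r
  proof
    let ?B = "sqrt r \<cdot>\<^sub>m Psim"
    let ?S = "four_block_mat S1 ?B ?B\<^sup>T S2"
    have B: "?B \<in> carrier_mat p q" using Psim by simp
    show S: "?S \<in> Gam"
      unfolding Gam_def Psim_def by (rule scaled_Psi_m_in_Gamma_set[OF S1 S2 E1 E2]) (use r in auto)
    have "cross_block p ?S = ?B"
      by (rule blocks_four_block_mat[OF a(4) B _ d(4)]) (use B in simp)
    moreover have "mat_trace (?B * ?B\<^sup>T) = r * K"
      unfolding K_def mat_trace_gram[OF B] mat_trace_gram[OF Psim] sum_distrib_left
      by (intro sum.cong refl) (use Psim r in \<open>simp add: power_mult_distrib\<close>)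
    ultimately show "RVbar ?S = r" using RVbar[OF S] K0 by simp
  qed
  show ?thesis
    using K Sigmam max RVbar bounds attained unfolding K_def by blast
qed

end
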